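(* Let $G$ be a graph. For every edge $e\in E(G)$, the equivalence class of $e$ under $\mathcal{C}_G$ is equal to $S_e$.
   Context: A quasi-transitive $2$-edge-colouring of a graph $G$ is a map $c: E(G)\to\{R,B\}$ such that for all pairs of edges $xy, yz \in E(G)$ with $c(xy)\neq c(yz)$, we have $xz\in E(G)$. $\mathcal{C}_G$ is the equivalence relation on $E(G)$ with $e\sim f$ iff $c(e)=c(f)$ for every quasi-transitive $2$-edge-colouring $c$ of $G$. For $e\in E(G)$, let $\mathcal{S}_e$ be the family of all sets $S\subseteq E(G)$ such that $e\in S$ and, for every edge $d\notin S$, there is no induced copy of $P_3$ in $G$ consisting of $d$ and an edge of $S$. $S_e$ denotes the member of $\mathcal{S}_e$ of minimum cardinality (it is unique; equivalently it is the intersection of all members of $\mathcal{S}_e$). *)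

theory Defs
  imports "HOL-Library.Ramsey"
begin

text \<open>
  A finite simple graph is given by its vertex set \<open>V\<close> and its edge set \<open>E\<close>, the edges being
  two-element sets of vertices.
\<close>

definition simple_graph :: "'a set \<Rightarrow> 'a set set \<Rightarrow> bool" where
  "simple_graph V E \<longleftrightarrow> finite V \<and> E \<subseteq> nsets V 2"

datatype colour = Red | Blue

text \<open>
  Only the values of a colouring on \<open>E\<close> matter. If \<open>x = z\<close>, the two edges coincide and the
  premise on colours is false.
\<close>

definition quasi_transitive :: "'a set set \<Rightarrow> ('a set \<Rightarrow> colour) \<Rightarrow> bool" where
  "quasi_transitive E c \<longleftrightarrow>
     (\<forall>x y z. {x, y} \<in> E \<longrightarrow> {y, z} \<in> E \<longrightarrow> c {x, y} \<noteq> c {y, z} \<longrightarrow> {x, z} \<in> E)"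

definition colour_equiv :: "'a set set \<Rightarrow> 'a set rel" where
  "colour_equiv E =
     {(e, f). e \<in> E \<and> f \<in> E \<and> (\<forall>c. quasi_transitive E c \<longrightarrow> c e = c f)}"

text \<open>Here \<open>P\<^sub>3\<close> is the path on three vertices.\<close>

definition induced_P3 :: "'a set set \<Rightarrow> 'a set \<Rightarrow> 'a set \<Rightarrow> bool" where
  "induced_P3 E d f \<longleftrightarrow>
     (\<exists>x y z. distinct [x, y, z] \<and> d = {x, y} \<and> f = {y, z} \<and>
        {x, y} \<in> E \<and> {y, z} \<in> E \<and> {x, z} \<notin> E)"

definition P3_family :: "'a set set \<Rightarrow> 'a set \<Rightarrow> 'a set set set" where
  "P3_family E e =
     {S. S \<subseteq> E \<and> e \<in> S \<and> (\<forall>d\<in>E - S. \<not> (\<exists>f\<in>S. induced_P3 E d f))}"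

definition P3_min :: "'a set set \<Rightarrow> 'a set \<Rightarrow> 'a set set" where
  "P3_min E e = (THE S. S \<in> P3_family E e \<and> (\<forall>T\<in>P3_family E e. card S \<le> card T))"

lemma simple_graph_finite_edges: "simple_graph V E \<Longrightarrow> finite E"
  unfolding simple_graph_def by (meson finite_imp_finite_nsets finite_subset)

lemma equiv_colour_equiv: "equiv E (colour_equiv E)"
  by (rule equivI) (auto simp: colour_equiv_def refl_on_def sym_def trans_def)

lemma Inter_in_P3_family:
  assumes "e \<in> E"
  shows "\<Inter> (P3_family E e) \<in> P3_family E e"
proof -
  have "E \<in> P3_family E e"
    using assms by (simp add: P3_family_def)
  then show ?thesis
    unfolding P3_family_def by blast
qed

lemma P3_min_unique:
  assumes "finite E" "e \<in> E"
  shows "\<exists>!S. S \<in> P3_family E e \<and> (\<forall>T\<in>P3_family E e. card S \<le> card T)"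
    and "P3_min E e = \<Inter> (P3_family E e)"
proof -
  let ?I = "\<Inter> (P3_family E e)"
  have fin: "finite T" if "T \<in> P3_family E e" for T
    using that assms(1) by (auto simp: P3_family_def intro: finite_subset)
  have I: "?I \<in> P3_family E e"
    using assms(2) by (rule Inter_in_P3_family)
  have min: "?I \<in> P3_family E e \<and> (\<forall>T\<in>P3_family E e. card ?I \<le> card T)"
    using I fin by (auto intro!: card_mono)
  have uniq: "S = ?I"
    if "S \<in> P3_family E e \<and> (\<forall>T\<in>P3_family E e. card S \<le> card T)" for S
    using that I fin card_seteq[of S ?I] by blast
  show "\<exists>!S. S \<in> P3_family E e \<and> (\<forall>T\<in>P3_family E e. card S \<le> card T)"
    using min uniq by blast
  show "P3_min E e = ?I"
    unfolding P3_min_def using min uniq by (rule the_equality)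
qed

end

theory Submission
  imports Defs
begin

text \<open>
  The two edges of an induced \<open>P\<^sub>3\<close> receive the same colour in every quasi-transitive
  colouring, so the class of \<open>e\<close> belongs to \<open>\<S>\<^sub>e\<close> and contains the smallest member.
  Conversely, for any member \<open>S\<close>, colouring \<open>S\<close> red and all other edges blue is
  quasi-transitive, so no edge outside \<open>S\<close> is equivalent to \<open>e\<close>.
\<close>

text \<open>Different colours would force the missing third pair to be an edge.\<close>

lemma induced_P3_same_colour:
  assumes "quasi_transitive E c" and "induced_P3 E d f"
  shows "c d = c f"
  using assms unfolding quasi_transitive_def induced_P3_def by blast

lemma induced_P3_in_edges:
  assumes "induced_P3 E d f"
  shows "d \<in> E"
  using assms unfolding induced_P3_def by blast

lemma colour_equiv_in_edges:
  assumes "(e, f) \<in> colour_equiv E"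
  shows "f \<in> E"
  using assms by (simp add: colour_equiv_def)

lemma colour_class_in_P3_family:
  assumes "e \<in> E"
  shows "colour_equiv E `` {e} \<in> P3_family E e"
proof -
  have "d \<in> colour_equiv E `` {e}"
    if f: "f \<in> colour_equiv E `` {e}" and P3: "induced_P3 E d f" for d f
  proof -
    have "c e = c d" if c: "quasi_transitive E c" for c
    proof -
      have "c e = c f"
        using f c by (simp add: colour_equiv_def)
      also have "\<dots> = c d"
        using induced_P3_same_colour[OF c P3] by simp
      finally show ?thesis .
    qed
    then show ?thesis
      using assms induced_P3_in_edges[OF P3] by (simp add: colour_equiv_def)
  qed
  then show ?thesis
    using assms equiv_class_self[OF equiv_colour_equiv]
    unfolding P3_family_def by (blast dest: colour_equiv_in_edges)
qed

text \<open>A violation would be an induced path with one edge in \<open>S\<close> and the other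
  outside, which membership in the family forbids.\<close>

lemma quasi_transitive_indicator:
  assumes edges: "\<And>x y. {x, y} \<in> E \<Longrightarrow> x \<noteq> y"
    and S: "S \<in> P3_family E e"
  shows "quasi_transitive E (\<lambda>f. if f \<in> S then Red else Blue)"
proof -
  have closed: "{x, z} \<in> E"
    if "{x, y} \<in> E" "{y, z} \<in> E" "{x, y} \<notin> S" "{y, z} \<in> S" for x y z
  proof (rule ccontr)
    assume "{x, z} \<notin> E"
    \<comment> \<open>Otherwise the two edges coincide as sets, yet only one of them lies in
      \<open>S\<close>.\<close>
    moreover have "x \<noteq> z"
      using that by (auto simp: insert_commute)
    ultimately have "induced_P3 E {x, y} {y, z}"
      using that edges unfolding induced_P3_def by auto
    then show False
      using S that unfolding P3_family_def by blast
  qed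
  show ?thesis
    unfolding quasi_transitive_def
  proof (intro allI impI)
    fix x y z
    assume xy: "{x, y} \<in> E" and yz: "{y, z} \<in> E"
      and "(if {x, y} \<in> S then Red else Blue) \<noteq> (if {y, z} \<in> S then Red else Blue)"
    then consider "{x, y} \<notin> S" "{y, z} \<in> S" | "{x, y} \<in> S" "{y, z} \<notin> S"
      by (auto split: if_splits)
    then show "{x, z} \<in> E"
    proof cases
      case 1
      then show ?thesis using closed xy yz by blast
    next
      case 2
      \<comment> \<open>Reading the path backwards puts the edge outside \<open>S\<close>
        first.\<close>
      then show ?thesis using closed[of z y x] xy yz by (simp add: insert_commute)
    qed
  qed
qed

text \<open>Holding for every member \<open>S\<close>, this bounds the class by the intersection of
  the family, which is \<open>P3_min E e\<close> for finite \<open>E\<close>.\<close>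

lemma colour_class_subset_P3_family:
  assumes "\<And>x y. {x, y} \<in> E \<Longrightarrow> x \<noteq> y" and S: "S \<in> P3_family E e"
  shows "colour_equiv E `` {e} \<subseteq> S"
proof
  fix f assume "f \<in> colour_equiv E `` {e}"
  then have "c e = c f" if "quasi_transitive E c" for c
    using that by (simp add: colour_equiv_def)
  \<comment> \<open>This colouring separates \<open>e\<close> from every edge outside
    \<open>S\<close>.\<close>
  from this[OF quasi_transitive_indicator[OF assms]]
  have "(if e \<in> S then Red else Blue) = (if f \<in> S then Red else Blue)" .
  moreover have "e \<in> S"
    using S by (simp add: P3_family_def)
  ultimately show "f \<in> S"
    by (simp split: if_splits)
qed

theorem theorem8:
  fixes V :: "'a set" and E :: "'a set set" and e :: "'a set"
  assumes "simple_graph V E" and "e \<in> E"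
  shows "colour_equiv E `` {e} = P3_min E e"
proof -
  have "x \<noteq> y" if "{x, y} \<in> E" for x y
    using that assms(1) unfolding simple_graph_def nsets_def by auto
  then have "colour_equiv E `` {e} \<subseteq> \<Inter> (P3_family E e)"
    by (intro Inter_greatest colour_class_subset_P3_family)
  moreover have "\<Inter> (P3_family E e) \<subseteq> colour_equiv E `` {e}"
    using assms(2) by (intro Inter_lower colour_class_in_P3_family)
  ultimately show ?thesis
    using P3_min_unique(2)[OF simple_graph_finite_edges[OF assms(1)] assms(2)] by simp
qed

end
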